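(* Let $H$ be a finite $3$-uniform hypergraph that is $(6,2)$-sparse. Then $H$ is metric.
   Context: Given a metric space $M=(X,\rho)$ and three distinct points $x,y,z\in X$, $y$ is said to be between $x$ and $z$ if $\rho(x,z)=\rho(x,y)+\rho(y,z)$; the triple $\{x,y,z\}$ is collinear if one of its points is between the other two. The hypergraph $H_M$ associated with $M$ is the $3$-uniform hypergraph whose vertices are the points of $M$ and whose hyperedges are exactly the collinear triples of $M$. A $3$-uniform hypergraph $H$ is metric if there is a metric space $M$ with $H_M=H$. A $3$-uniform hypergraph is $(k,\ell)$-sparse if every $k$-element subset $X$ of its vertices contains at most $\ell$ hyperedges with all their vertices in $X$. *)

theory Defs
  imports "HOL-Analysis.Abstract_Metric_Spaces"
begin

definition between :: "'a metric \<Rightarrow> 'a \<Rightarrow> 'a \<Rightarrow> 'a \<Rightarrow> bool" where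
  "between M x y z \<longleftrightarrow>
     x \<in> mspace M \<and> y \<in> mspace M \<and> z \<in> mspace M \<and>
     x \<noteq> y \<and> y \<noteq> z \<and> x \<noteq> z \<and>
     mdist M x z = mdist M x y + mdist M y z"

(* Since x, y, z range over all labellings of the triple, it suffices to ask that the
   point labelled y is the middle one. *)
definition collinear_triple :: "'a metric \<Rightarrow> 'a set \<Rightarrow> bool" where
  "collinear_triple M T \<longleftrightarrow> (\<exists>x y z. T = {x, y, z} \<and> between M x y z)"

type_synonym 'a hypergraph = "'a set \<times> 'a set set"

abbreviation verts :: "'a hypergraph \<Rightarrow> 'a set" where
  "verts H \<equiv> fst H"

abbreviation hyperedges :: "'a hypergraph \<Rightarrow> 'a set set" where
  "hyperedges H \<equiv> snd H"

definition uniform3 :: "'a hypergraph \<Rightarrow> bool" where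
  "uniform3 H \<longleftrightarrow> (\<forall>e \<in> hyperedges H. e \<subseteq> verts H \<and> card e = 3)"

definition metric_hypergraph :: "'a metric \<Rightarrow> 'a hypergraph" where
  "metric_hypergraph M = (mspace M, {T. collinear_triple M T})"

(* Equality of hypergraphs includes equality of the vertex sets, so a metric space
   inducing H has carrier verts H; no generality is lost by keeping the point type. *)
definition is_metric :: "'a hypergraph \<Rightarrow> bool" where
  "is_metric H \<longleftrightarrow> (\<exists>M. metric_hypergraph M = H)"

definition sparse :: "nat \<Rightarrow> nat \<Rightarrow> 'a hypergraph \<Rightarrow> bool" where
  "sparse k l H \<longleftrightarrow>
     (\<forall>X. X \<subseteq> verts H \<and> finite X \<and> card X = k \<longrightarrow>
        card {e \<in> hyperedges H. e \<subseteq> X} \<le> l)"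

end

theory Submission
  imports Defs
begin

text \<open>If \<open>H\<close> has at least six vertices, sparsity says that any three distinct edges span at least
  seven vertices.  Hence an edge shares two vertices with at most one other edge, and one can choose
  a vertex \<open>m e\<close> of each edge \<open>e\<close> so that edges sharing two vertices choose the same one.
  Distance 2 between the two vertices of \<open>e\<close> other than \<open>m e\<close>, distance 1 between \<open>m e\<close> and
  these, and distance 3/2 elsewhere give a metric in which a collinear triple must have distances
  2, 1, 1; its three pairs lie in edges, and if these edges were distinct they would
  span at most six vertices.

  On at most five vertices sparsity is void, and all 34 isomorphism types have to be
  realised.  Among all labellings of the vertices by numbers below 5, take one
  for which the incidence word of the ten triples is lexicographically largest.  Comparing it with
  its images under the four adjacent transpositions leaves only 46 words, each realised
  by an explicit integer metric.\<close>

section \<open>From a distance function to a metric hypergraph\<close>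

text \<open>Polymorphic, so as to serve both natural-number tables, where it can be evaluated, and
  real distances.\<close>

definition degenerate :: "'a::plus \<Rightarrow> 'a \<Rightarrow> 'a \<Rightarrow> bool" where
  "degenerate a b c \<longleftrightarrow> a = b + c \<or> b = a + c \<or> c = a + b"

text \<open>Both cases of the theorem build their metric through this rule. Non-negativity and
  symmetry range over the whole type because \<open>Metric_space\<close> asks for them
  there.\<close>

lemma is_metricI:
  fixes D :: "'a \<Rightarrow> 'a \<Rightarrow> real"
  assumes unif: "uniform3 H"
    and nonneg: "\<And>x y. 0 \<le> D x y"
    and sym: "\<And>x y. D x y = D y x"
    and zero: "\<And>x y. x \<in> verts H \<Longrightarrow> y \<in> verts H \<Longrightarrow> D x y = 0 \<longleftrightarrow> x = y"
    and tri: "\<And>x y z. x \<in> verts H \<Longrightarrow> y \<in> verts H \<Longrightarrow> z \<in> verts H \<Longrightarrow> D x z \<le> D x y + D y z"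
    and edge: "\<And>x y z. x \<in> verts H \<Longrightarrow> y \<in> verts H \<Longrightarrow> z \<in> verts H \<Longrightarrow>
      x \<noteq> y \<Longrightarrow> y \<noteq> z \<Longrightarrow> x \<noteq> z \<Longrightarrow>
      degenerate (D x y) (D x z) (D y z) \<longleftrightarrow> {x, y, z} \<in> hyperedges H"
  shows "is_metric H"
proof -
  interpret Metric_space "verts H" D
    by unfold_locales (use nonneg sym zero tri in auto)
  define M where "M = metric (verts H, D)"
  have sp: "mspace M = verts H" and dist: "mdist M = D"
    by (simp_all add: M_def)
  have "collinear_triple M S \<longleftrightarrow> S \<in> hyperedges H" for S
  proof
    assume "collinear_triple M S"
    then obtain x y z where S: "S = {x, y, z}" and b: "between M x y z"
      by (auto simp: collinear_triple_def)
    have "degenerate (D x y) (D x z) (D y z)"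
      using b by (simp add: between_def dist degenerate_def)
    then show "S \<in> hyperedges H"
      using b edge[of x y z] by (simp add: S between_def sp)
  next
    assume S: "S \<in> hyperedges H"
    then have sub: "S \<subseteq> verts H" and "card S = 3"
      using unif by (auto simp: uniform3_def)
    then obtain x y z where xyz: "S = {x, y, z}" "x \<noteq> y" "y \<noteq> z" "x \<noteq> z"
      by (metis card_3_iff)
    then have "degenerate (D x y) (D x z) (D y z)"
      using edge[of x y z] S sub by simp
    then have "between M x z y \<or> between M x y z \<or> between M y x z"
      using xyz sub by (auto simp: between_def sp dist degenerate_def sym)
    moreover have "S = {x, z, y}" "S = {y, x, z}"
      using xyz(1) by auto
    ultimately show "collinear_triple M S"
      unfolding collinear_triple_def using xyz(1) by blast
  qed
  then have "metric_hypergraph M = H"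
    by (simp add: metric_hypergraph_def sp prod_eq_iff)
  then show ?thesis
    by (auto simp: is_metric_def)
qed

section \<open>At most five vertices\<close>

text \<open>A metric on \<open>{0, \<dots>, 4}\<close> is given by the rows of its lower triangular distance matrix.\<close>

definition lower_dist :: "nat list list \<Rightarrow> nat \<Rightarrow> nat \<Rightarrow> nat" where
  "lower_dist t i j = t ! max i j ! min i j"

text \<open>The lexicographic order fixes the place of each triple in every word; the position lists
  in \<open>leader\<close> refer to it.\<close>

definition triples5 :: "(nat \<times> nat \<times> nat) list" where
  "triples5 = [(0,1,2), (0,1,3), (0,1,4), (0,2,3), (0,2,4),
    (0,3,4), (1,2,3), (1,2,4), (1,3,4), (2,3,4)]"

definition pattern :: "nat list list \<Rightarrow> bool list" where
  "pattern t = map (\<lambda>(i, j, k).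
     degenerate (lower_dist t i j) (lower_dist t i k) (lower_dist t j k)) triples5"

text \<open>A word that passes the four transposition tests need not be largest in its orbit, so
  there are more tables than isomorphism types.\<close>

definition metrics5 :: "nat list list list" where
  "metrics5 =
  [[[0],[1,0],[1,1,0],[1,1,1,0],[1,1,1,1,0]],
   [[0],[1,0],[1,2,0],[2,2,2,0],[2,2,2,1,0]],
   [[0],[2,0],[3,1,0],[2,2,2,0],[3,2,2,1,0]],
   [[0],[1,0],[2,3,0],[2,2,2,0],[3,3,2,1,0]],
   [[0],[1,0],[1,2,0],[2,2,2,0],[3,3,3,1,0]],
   [[0],[1,0],[1,2,0],[1,2,1,0],[2,2,2,2,0]],
   [[0],[1,0],[2,3,0],[2,3,1,0],[2,2,2,3,0]],
   [[0],[1,0],[1,2,0],[2,1,2,0],[2,2,1,2,0]],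
   [[0],[1,0],[1,2,0],[1,2,1,0],[2,2,1,2,0]],
   [[0],[1,0],[1,2,0],[2,1,2,0],[1,1,2,2,0]],
   [[0],[1,0],[1,2,0],[1,2,1,0],[1,1,2,1,0]],
   [[0],[2,0],[2,4,0],[2,4,2,0],[3,3,1,2,0]],
   [[0],[2,0],[1,1,0],[1,1,1,0],[2,2,1,2,0]],
   [[0],[1,0],[1,2,0],[1,2,1,0],[1,1,2,2,0]],
   [[0],[1,0],[2,3,0],[2,3,2,0],[3,3,1,1,0]],
   [[0],[2,0],[3,1,0],[1,3,3,0],[2,2,1,3,0]],
   [[0],[2,0],[4,2,0],[2,4,4,0],[3,3,1,5,0]],
   [[0],[2,0],[1,1,0],[1,1,1,0],[2,2,1,1,0]],
   [[0],[2,0],[2,4,0],[2,4,2,0],[3,3,1,1,0]],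
   [[0],[1,0],[1,2,0],[1,2,2,0],[2,2,2,2,0]],
   [[0],[2,0],[2,4,0],[1,3,3,0],[2,2,2,2,0]],
   [[0],[2,0],[1,3,0],[1,3,2,0],[2,1,2,2,0]],
   [[0],[1,0],[1,2,0],[1,2,2,0],[1,1,1,1,0]],
   [[0],[1,0],[1,2,0],[2,1,1,0],[2,2,2,2,0]],
   [[0],[1,0],[1,2,0],[1,2,1,0],[1,2,1,1,0]],
   [[0],[1,0],[2,3,0],[2,3,1,0],[2,3,1,2,0]],
   [[0],[1,0],[1,2,0],[1,2,2,0],[2,1,2,2,0]],
   [[0],[1,0],[1,2,0],[1,2,2,0],[1,2,1,1,0]],
   [[0],[1,0],[2,3,0],[1,2,3,0],[2,1,2,2,0]],
   [[0],[1,0],[3,4,0],[5,4,2,0],[3,2,2,4,0]],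
   [[0],[2,0],[2,4,0],[2,4,4,0],[3,1,3,3,0]],
   [[0],[1,0],[2,3,0],[2,3,4,0],[2,1,2,2,0]],
   [[0],[1,0],[1,2,0],[2,1,3,0],[2,3,2,3,0]],
   [[0],[1,0],[1,2,0],[2,1,1,0],[1,2,1,2,0]],
   [[0],[1,0],[1,2,0],[1,2,2,0],[1,2,2,1,0]],
   [[0],[2,0],[1,3,0],[4,2,3,0],[4,2,3,4,0]],
   [[0],[1,0],[1,2,0],[3,2,2,0],[3,2,2,4,0]],
   [[0],[1,0],[1,2,0],[2,1,1,0],[1,2,2,2,0]],
   [[0],[1,0],[1,2,0],[2,1,3,0],[2,3,3,2,0]],
   [[0],[1,0],[1,2,0],[2,1,1,0],[2,3,3,2,0]],
   [[0],[1,0],[1,2,0],[2,1,1,0],[2,1,1,1,0]],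
   [[0],[1,0],[1,2,0],[1,2,2,0],[1,2,2,2,0]],
   [[0],[2,0],[2,4,0],[4,2,2,0],[1,3,3,3,0]],
   [[0],[1,0],[2,1,0],[1,2,3,0],[1,2,3,2,0]],
   [[0],[2,0],[1,1,0],[1,1,2,0],[1,1,2,2,0]],
   [[0],[1,0],[1,2,0],[2,1,3,0],[2,3,1,4,0]]]"

section \<open>Search for the lexicographic leaders\<close>

fun lex_ge :: "bool list \<Rightarrow> bool list \<Rightarrow> bool" where
  "lex_ge [] _ \<longleftrightarrow> True"
| "lex_ge (x # xs) [] \<longleftrightarrow> True"
| "lex_ge (x # xs) (y # ys) \<longleftrightarrow> (if x = y then lex_ge xs ys else x)"

text \<open>The position lists describe the action of the transpositions (0 1), (1 2), (2 3), (3 4)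
  on the triples.\<close>

definition leader :: "bool list \<Rightarrow> bool" where
  "leader w \<longleftrightarrow> (\<forall>s\<in>set
     [[0,1,2,6,7,8,3,4,5,9], [0,3,4,1,2,5,6,7,9,8], [1,0,2,3,5,4,6,8,7,9], [0,2,1,4,3,5,7,6,8,9]].
     lex_ge w (map ((!) w) s))"

text \<open>Recursion on the letters, rather than membership in the list of all words of length 10, keeps
  the terms small when the simplifier evaluates this.\<close>

fun leaders_in :: "nat \<Rightarrow> bool list \<Rightarrow> bool list list \<Rightarrow> bool" where
  "leaders_in 0 p L \<longleftrightarrow> (if L = [] then \<not> leader (rev p) else True)"
| "leaders_in (Suc n) p L \<longleftrightarrow>
     leaders_in n (True # p) (map tl (filter hd L)) \<and>
     leaders_in n (False # p) (map tl (filter (\<lambda>l. \<not> hd l) L))"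

text \<open>\<open>leaders_in\<close> walks the binary tree of words: \<open>p\<close> is the
  reversed prefix read so far, and \<open>L\<close> holds the remainders of the listed words that
  agree with it. At a leaf, an empty \<open>L\<close> means that the word is not listed, and then it
  must fail \<open>leader\<close>.\<close>

lemma leaders_inD:
  assumes "leaders_in n p L" "length w = n" "\<forall>l\<in>set L. length l = n" "leader (rev p @ w)"
  shows "w \<in> set L"
  using assms
proof (induction n arbitrary: p L w)
  case 0
  then show ?case
    by (cases L) auto
next
  case (Suc n)
  then obtain b v where w: "w = b # v" "length v = n"
    by (metis length_Suc_conv)
  define L' where "L' = map tl (filter (\<lambda>l. hd l = b) L)"
  have "leaders_in n (b # p) L'"
    using Suc.prems(1) by (cases b) (simp_all add: L'_def)
  moreover have "\<forall>l\<in>set L'. length l = n"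
    using Suc.prems(3) by (auto simp: L'_def)
  moreover have "leader (rev (b # p) @ v)"
    using Suc.prems(4) w by simp
  ultimately have "v \<in> set L'"
    using Suc.IH w(2) by blast
  then obtain l where l: "l \<in> set L" "hd l = b" "tl l = v"
    by (auto simp: L'_def)
  moreover have "l \<noteq> []"
    using Suc.prems(3) l(1) by force
  ultimately show ?case
    using w(1) list.collapse by fastforce
qed

text \<open>Completeness of the table: of all 1024 words, each one outside it is smaller than one of
  its four images.\<close>

lemma leaders_realised:
  "leaders_in 10 [] (map pattern metrics5)"
  by code_simp

lemma metrics5_are_metrics:
  "\<forall>t\<in>set metrics5. \<forall>i\<in>set [0..<5]. \<forall>j\<in>set [0..<5].
     (lower_dist t i j = 0 \<longleftrightarrow> i = j) \<and>
     (\<forall>k\<in>set [0..<5]. lower_dist t i k \<le> lower_dist t i j + lower_dist t j k)"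
  by code_simp

lemma
  assumes "t \<in> set metrics5" "i < 5" "j < 5"
  shows metrics5_zero: "lower_dist t i j = 0 \<longleftrightarrow> i = j"
    and metrics5_triangle: "k < 5 \<Longrightarrow> lower_dist t i k \<le> lower_dist t i j + lower_dist t j k"
  using metrics5_are_metrics assms by auto

lemma lower_dist_sym: "lower_dist t i j = lower_dist t j i"
  by (simp add: lower_dist_def max.commute min.commute)

lemma increasing_in_triples5:
  assumes "i < j" "j < k" "k < 5"
  shows "(i, j, k) \<in> set triples5"
proof -
  have "\<forall>i\<in>set [0..<5]. \<forall>j\<in>set [0..<5]. \<forall>k\<in>set [0..<5].
      i < j \<longrightarrow> j < k \<longrightarrow> (i, j, k) \<in> set triples5"
    by code_simp
  then show ?thesis
    using assms by auto
qed

section \<open>Incidence words of labelled hypergraphs\<close>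

definition incidence :: "nat set set \<Rightarrow> bool list" where
  "incidence F = map (\<lambda>(i, j, k). {i, j, k} \<in> F) triples5"

lemma length_incidence [simp]: "length (incidence F) = 10"
  by (simp add: incidence_def triples5_def)

text \<open>A transposition is its own inverse, also on sets, so image and preimage of a family
  coincide.\<close>

lemma mem_image_transpose:
  "A \<in> (`) (Transposition.transpose a b) ` F \<longleftrightarrow> Transposition.transpose a b ` A \<in> F"
proof -
  have "Transposition.transpose a b ` Transposition.transpose a b ` B = B" for B
    by (simp add: image_comp)
  then show ?thesis
    by (metis (no_types, lifting) image_iff)
qed

text \<open>The words only record increasing triples; the symmetry of \<open>degenerate\<close> and
  of \<open>lower_dist\<close> carries this to all six orders.\<close>

lemma pattern_eq_incidenceD:
  assumes eq: "pattern t = incidence F"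
    and "i < 5" "j < 5" "k < 5" "i \<noteq> j" "j \<noteq> k" "i \<noteq> k"
  shows "degenerate (lower_dist t i j) (lower_dist t i k) (lower_dist t j k) \<longleftrightarrow> {i, j, k} \<in> F"
proof -
  have *: "degenerate (lower_dist t i j) (lower_dist t i k) (lower_dist t j k) \<longleftrightarrow> {i, j, k} \<in> F"
    if "i < j" "j < k" "k < 5" for i j k
    using eq increasing_in_triples5[OF that]
    by (auto simp: pattern_def incidence_def)
  consider "i < j" "j < k" | "i < k" "k < j" | "j < i" "i < k"
    | "j < k" "k < i" | "k < i" "i < j" | "k < j" "j < i"
    using assms by linarith
  then show ?thesis
  proof cases
    case 1 then show ?thesis using *[of i j k] assms by simp
  next
    case 2 then show ?thesis using *[of i k j] assms
      by (auto simp: degenerate_def lower_dist_sym[of t k j] insert_commute add.commute)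
  next
    case 3 then show ?thesis using *[of j i k] assms
      by (auto simp: degenerate_def lower_dist_sym[of t j i] insert_commute add.commute)
  next
    case 4 then show ?thesis using *[of j k i] assms
      by (auto simp: degenerate_def lower_dist_sym[of t j i] lower_dist_sym[of t k i]
          insert_commute add.commute)
  next
    case 5 then show ?thesis using *[of k i j] assms
      by (auto simp: degenerate_def lower_dist_sym[of t k i] lower_dist_sym[of t k j]
          insert_commute add.commute)
  next
    case 6 then show ?thesis using *[of k j i] assms
      by (auto simp: degenerate_def lower_dist_sym[of t k i] lower_dist_sym[of t k j]
          lower_dist_sym[of t j i] insert_commute add.commute)
  qed
qed

section \<open>Maximal labellings\<close>

text \<open>The word read in binary. \<open>horner_sum\<close> takes the least significant bit
  first, so \<open>rev\<close> makes the first triple the most significant.\<close>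

abbreviation weight :: "nat set set \<Rightarrow> nat" where
  "weight F \<equiv> horner_sum of_bool 2 (rev (incidence F))"

text \<open>The leading bit outweighs everything that the remaining bits can contribute.\<close>

lemma lex_ge_iff_horner_sum:
  assumes "length xs = length ys"
  shows "lex_ge xs ys \<longleftrightarrow>
    (horner_sum of_bool 2 (rev ys) :: nat) \<le> horner_sum of_bool 2 (rev xs)"
  using assms
proof (induction xs ys rule: list_induct2)
  case (Cons x xs y ys)
  have "horner_sum of_bool 2 (rev xs) < (2 :: nat) ^ length ys"
    "horner_sum of_bool 2 (rev ys) < (2 :: nat) ^ length ys"
    using horner_sum_of_bool_2_less[of "rev xs", where 'a = nat]
      horner_sum_of_bool_2_less[of "rev ys", where 'a = nat] Cons.hyps by simp_all
  then show ?case
    using Cons by (cases x; cases y) (simp_all add: horner_sum_append)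
qed simp

lemma incidence_image_transpose:
  "incidence ((`) (Transposition.transpose a b) ` F) =
     map (\<lambda>(i, j, k). {Transposition.transpose a b i, Transposition.transpose a b j,
       Transposition.transpose a b k} \<in> F) triples5"
  by (simp add: incidence_def mem_image_transpose)

lemma leader_if_maximal:
  assumes "\<And>i. i < 4 \<Longrightarrow> weight ((`) (Transposition.transpose i (Suc i)) ` F) \<le> weight F"
  shows "leader (incidence F)"
proof -
  have lex: "lex_ge (incidence F) (incidence ((`) (Transposition.transpose i (Suc i)) ` F))"
    if "i < 4" for i
    using assms[OF that] by (simp add: lex_ge_iff_horner_sum)
  \<comment> \<open>Each entry is the position of the image of a triple, once that image is put in
    increasing order.\<close>
  have "map ((!) (incidence F)) [0,1,2,6,7,8,3,4,5,9] =
      incidence ((`) (Transposition.transpose 0 (Suc 0)) ` F)"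
    "map ((!) (incidence F)) [0,3,4,1,2,5,6,7,9,8] =
      incidence ((`) (Transposition.transpose 1 (Suc 1)) ` F)"
    "map ((!) (incidence F)) [1,0,2,3,5,4,6,8,7,9] =
      incidence ((`) (Transposition.transpose 2 (Suc 2)) ` F)"
    "map ((!) (incidence F)) [0,2,1,4,3,5,7,6,8,9] =
      incidence ((`) (Transposition.transpose 3 (Suc 3)) ` F)"
    unfolding incidence_image_transpose
    by (simp_all add: incidence_def triples5_def Transposition.transpose_def insert_commute
        numeral_eq_Suc)
  then show ?thesis
    unfolding leader_def using lex[of 0] lex[of 1] lex[of 2] lex[of 3] by (simp del: list.map)
qed

lemma is_metric_card_le_5:
  assumes fin: "finite (verts H)" and unif: "uniform3 H" and card: "card (verts H) \<le> 5"
  shows "is_metric H"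
proof -
  \<comment> \<open>With fewer than five vertices some labels stay idle and lie in no edge;
    restricting a five-point metric to the used labels covers all sizes at once.\<close>
  define label where "label h \<longleftrightarrow> inj_on h (verts H) \<and> h ` verts H \<subseteq> {..<5}"
    for h :: "'a \<Rightarrow> nat"
  define E where "E h = (`) h ` hyperedges H" for h :: "'a \<Rightarrow> nat"
  obtain h0 where "bij_betw h0 (verts H) {0..<card (verts H)}"
    using ex_bij_betw_finite_nat[OF fin] by blast
  then have "label h0"
    using card by (auto simp: label_def bij_betw_def)
  \<comment> \<open>Words have ten letters; the bound yields a labelling of greatest weight.\<close>
  moreover have "\<forall>h. label h \<longrightarrow> weight (E h) < 2 ^ 10"
    using horner_sum_of_bool_2_less[where 'a = nat] by (metis length_incidence length_rev)
  ultimately obtain h where h: "label h" and max: "\<And>g. label g \<Longrightarrow> weight (E g) \<le> weight (E h)"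
    using ex_has_greatest_nat[of label h0 "\<lambda>h. weight (E h)"] by (metis less_imp_le)
  have "weight ((`) (Transposition.transpose i (Suc i)) ` E h) \<le> weight (E h)" if "i < 4" for i
  proof -
    have "label (Transposition.transpose i (Suc i) \<circ> h)"
      using h that by (auto simp: label_def Transposition.transpose_def inj_on_def)
    moreover have "E (Transposition.transpose i (Suc i) \<circ> h) =
        (`) (Transposition.transpose i (Suc i)) ` E h"
      by (simp add: E_def image_image image_comp)
    ultimately show ?thesis
      using max by metis
  qed
  then have "leader (incidence (E h))"
    by (rule leader_if_maximal)
  then have "incidence (E h) \<in> set (map pattern metrics5)"
    by (intro leaders_inD[OF leaders_realised]) (simp_all add: pattern_def triples5_def)
  then obtain t where t: "t \<in> set metrics5" "pattern t = incidence (E h)"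
    by auto
  define D where "D x y = real (lower_dist t (h x) (h y))" for x y
  have h5: "h x < 5" if "x \<in> verts H" for x
    using h that by (auto simp: label_def)
  have h_inj: "h x = h y \<longleftrightarrow> x = y" if "x \<in> verts H" "y \<in> verts H" for x y
    using h that by (auto simp: label_def inj_on_def)
  show ?thesis
  proof (rule is_metricI[where D = D, OF unif])
    fix x y z assume xyz: "x \<in> verts H" "y \<in> verts H" "z \<in> verts H"
    show "D x z \<le> D x y + D y z"
      using metrics5_triangle[OF t(1), of "h x" "h y" "h z"] h5 xyz
      unfolding D_def of_nat_add[symmetric] of_nat_le_iff by blast
    assume "x \<noteq> y" "y \<noteq> z" "x \<noteq> z"
    have "{h x, h y, h z} \<in> E h \<longleftrightarrow> {x, y, z} \<in> hyperedges H"
    proof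
      assume "{h x, h y, h z} \<in> E h"
      then obtain e where e: "e \<in> hyperedges H" "h ` {x, y, z} = h ` e"
        by (auto simp: E_def)
      moreover have "e \<subseteq> verts H"
        using e(1) unif by (auto simp: uniform3_def)
      ultimately have "{x, y, z} = e"
        using h xyz inj_on_image_eq_iff[of h "verts H" "{x, y, z}" e] by (simp add: label_def)
      then show "{x, y, z} \<in> hyperedges H"
        using e(1) by simp
    next
      assume "{x, y, z} \<in> hyperedges H"
      then have "h ` {x, y, z} \<in> E h"
        unfolding E_def by (rule imageI)
      then show "{h x, h y, h z} \<in> E h"
        by simp
    qed
    then show "degenerate (D x y) (D x z) (D y z) \<longleftrightarrow> {x, y, z} \<in> hyperedges H"
      using pattern_eq_incidenceD[OF t(2), of "h x" "h y" "h z"] h5 h_inj xyz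
        \<open>x \<noteq> y\<close> \<open>y \<noteq> z\<close> \<open>x \<noteq> z\<close>
      by (simp add: D_def degenerate_def flip: of_nat_add)
  next
    fix x y assume "x \<in> verts H" "y \<in> verts H"
    then show "D x y = 0 \<longleftrightarrow> x = y"
      using metrics5_zero[OF t(1), of "h x" "h y"] h5 h_inj by (simp add: D_def)
  qed (simp_all add: D_def lower_dist_sym)
qed

section \<open>At least six vertices\<close>

text \<open>Otherwise the union could be padded with vertices to a six-element set containing three
  edges; padding is possible since there are six vertices.\<close>

lemma three_edges_span:
  assumes fin: "finite (verts H)" and six: "6 \<le> card (verts H)"
    and unif: "uniform3 H" and sparse: "sparse 6 2 H"
    and efg: "e \<in> hyperedges H" "f \<in> hyperedges H" "g \<in> hyperedges H"
    and ne: "e \<noteq> f" "f \<noteq> g" "e \<noteq> g"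
  shows "6 < card (e \<union> f \<union> g)"
proof (rule ccontr)
  assume "\<not> 6 < card (e \<union> f \<union> g)"
  moreover have "e \<union> f \<union> g \<subseteq> verts H"
    using unif efg by (auto simp: uniform3_def)
  ultimately obtain X where X: "e \<union> f \<union> g \<subseteq> X" "X \<subseteq> verts H" "card X = 6"
    using exists_subset_between[OF _ six _ fin] by (metis not_less)
  then have finX: "finite X"
    using fin finite_subset by blast
  have "card {e, f, g} \<le> card {e \<in> hyperedges H. e \<subseteq> X}"
  proof (rule card_mono)
    show "finite {e \<in> hyperedges H. e \<subseteq> X}"
      by (rule finite_subset[of _ "Pow X"]) (use finX in auto)
    show "{e, f, g} \<subseteq> {e \<in> hyperedges H. e \<subseteq> X}"
      using X(1) efg by blast
  qed
  also have "\<dots> \<le> 2"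
    using sparse X(2,3) finX unfolding sparse_def by blast
  finally show False
    using ne by simp
qed

text \<open>\<open>m e\<close> is to be the middle point of \<open>e\<close>. Agreement on edges
  sharing two vertices prevents a pair from having to be at distance 1 and at distance 2 at
  once.\<close>

lemma exists_middle:
  assumes fin: "finite (verts H)" and six: "6 \<le> card (verts H)"
    and unif: "uniform3 H" and sparse: "sparse 6 2 H"
  obtains m where "\<And>e. e \<in> hyperedges H \<Longrightarrow> m e \<in> e"
    and "\<And>e f. e \<in> hyperedges H \<Longrightarrow> f \<in> hyperedges H \<Longrightarrow> 2 \<le> card (e \<inter> f) \<Longrightarrow> m e = m f"
proof -
  define twin where "twin e f \<longleftrightarrow> f \<in> hyperedges H \<and> f \<noteq> e \<and> 2 \<le> card (e \<inter> f)" for e f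
  define m where "m e = (SOME v. v \<in> e \<and> (\<forall>f. twin e f \<longrightarrow> v \<in> f))" for e
  have card3: "card e = 3" "finite e" if "e \<in> hyperedges H" for e
    using that unif by (auto simp: uniform3_def intro: card_ge_0_finite)
  have twin_unique: "f = g" if e: "e \<in> hyperedges H" and "twin e f" "twin e g" for e f g
  proof (rule ccontr)
    assume "f \<noteq> g"
    have fg: "f \<in> hyperedges H" "g \<in> hyperedges H"
      using that by (auto simp: twin_def)
    \<comment> \<open>Both \<open>f\<close> and \<open>g\<close> have at most one vertex outside
      \<open>e\<close>, so the three edges span at most 3 + 1 + 1 vertices.\<close>
    have "card (e \<union> f) \<le> 4"
      using card_Un_Int[of e f] card3[OF e] card3[OF fg(1)] \<open>twin e f\<close> by (simp add: twin_def)
    moreover have "card (g - e) \<le> 1"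
    proof -
      have "card (g - e) = 3 - card (e \<inter> g)"
        using card_Diff_subset_Int[of g e] card3[OF e] card3[OF fg(2)] by (simp add: Int_commute)
      moreover have "2 \<le> card (e \<inter> g)"
        using \<open>twin e g\<close> by (simp add: twin_def)
      ultimately show ?thesis
        by linarith
    qed
    moreover have "e \<union> f \<union> g = (e \<union> f) \<union> (g - e)"
      by auto
    ultimately have "card (e \<union> f \<union> g) \<le> 5"
      using card_Un_le[of "e \<union> f" "g - e"] by simp
    moreover have "6 < card (e \<union> f \<union> g)"
      by (rule three_edges_span[OF assms e fg])
        (use that \<open>f \<noteq> g\<close> in \<open>auto simp: twin_def\<close>)
    ultimately show False
      by simp
  qed
  have m: "m e \<in> e \<and> (\<forall>f. twin e f \<longrightarrow> m e \<in> f)" if e: "e \<in> hyperedges H" for e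
    unfolding m_def
  proof (rule someI_ex, cases "\<exists>f. twin e f")
    case True
    then obtain f where f: "twin e f" ..
    then have "e \<inter> f \<noteq> {}"
      by (auto simp: twin_def)
    then show "\<exists>v. v \<in> e \<and> (\<forall>f. twin e f \<longrightarrow> v \<in> f)"
      using twin_unique[OF e f] by auto
  next
    case False
    moreover have "e \<noteq> {}"
      using card3[OF e] by auto
    ultimately show "\<exists>v. v \<in> e \<and> (\<forall>f. twin e f \<longrightarrow> v \<in> f)"
      by auto
  qed
  have "m e = m f" if ef: "e \<in> hyperedges H" "f \<in> hyperedges H" "2 \<le> card (e \<inter> f)" for e f
  proof (cases "e = f")
    case False
    then have tw: "twin e f" "twin f e"
      using ef by (auto simp: twin_def Int_commute)
    \<comment> \<open>As twins are unique, both conditions describe \<open>e \<inter> f\<close>, so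
      \<open>SOME\<close> picks the same vertex.\<close>
    have "(v \<in> e \<and> (\<forall>g. twin e g \<longrightarrow> v \<in> g)) \<longleftrightarrow> (v \<in> f \<and> (\<forall>g. twin f g \<longrightarrow> v \<in> g))" for v
      using tw twin_unique[OF ef(1) tw(1)] twin_unique[OF ef(2) tw(2)] by blast
    then show ?thesis
      by (simp add: m_def)
  qed simp
  with m that show thesis
    by blast
qed

lemma is_metric_card_ge_6:
  assumes fin: "finite (verts H)" and six: "6 \<le> card (verts H)"
    and unif: "uniform3 H" and sparse: "sparse 6 2 H"
  shows "is_metric H"
proof -
  obtain m where m_in: "\<And>e. e \<in> hyperedges H \<Longrightarrow> m e \<in> e"
    and m_eq: "\<And>e f. e \<in> hyperedges H \<Longrightarrow> f \<in> hyperedges H \<Longrightarrow> 2 \<le> card (e \<inter> f) \<Longrightarrow> m e = m f"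
    using exists_middle[OF assms] by metis
  define near where "near x y \<longleftrightarrow> (\<exists>e\<in>hyperedges H. x \<in> e \<and> y \<in> e)" for x y
  define far where "far x y \<longleftrightarrow> (\<exists>e\<in>hyperedges H. x \<in> e \<and> y \<in> e \<and> m e \<noteq> x \<and> m e \<noteq> y)" for x y
  \<comment> \<open>Nonzero distances lie between 1 and 2, which gives the triangle inequality. Far
    pairs are also near, hence the order of the tests.\<close>
  define D :: "'a \<Rightarrow> 'a \<Rightarrow> real" where
    "D x y = (if x = y then 0 else if far x y then 2 else if near x y then 1 else 3 / 2)" for x y
  have card3: "card e = 3" "finite e" if "e \<in> hyperedges H" for e
    using that unif by (auto simp: uniform3_def intro: card_ge_0_finite)
  have two_common: "m e = m f" if "e \<in> hyperedges H" "f \<in> hyperedges H" "x \<noteq> y" "{x, y} \<subseteq> e \<inter> f"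
    for e f x y
  proof (rule m_eq[OF that(1,2)])
    have "card {x, y} \<le> card (e \<inter> f)"
      using that card3 by (intro card_mono) auto
    then show "2 \<le> card (e \<inter> f)"
      using that by simp
  qed
  have sym: "D x y = D y x" for x y
    by (auto simp: D_def near_def far_def)
  have closed: "{x, y, z} \<in> hyperedges H"
    if near: "near x y" "near x z" "near y z" and ne: "x \<noteq> y" "y \<noteq> z" "x \<noteq> z" for x y z
  proof -
    obtain e f g where e: "e \<in> hyperedges H" "x \<in> e" "y \<in> e" and f: "f \<in> hyperedges H" "x \<in> f" "z \<in> f"
      and g: "g \<in> hyperedges H" "y \<in> g" "z \<in> g"
      using near by (auto simp: near_def)
    have third: "\<exists>w. d = {u, v, w}" if "d \<in> hyperedges H" "u \<in> d" "v \<in> d" "u \<noteq> v" for d u v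
    proof -
      have "card (d - {u, v}) = 1"
        using that card3[of d] by (simp add: card_Diff_subset)
      then obtain w where "d - {u, v} = {w}"
        by (auto simp: card_1_singleton_iff)
      then have "d = {u, v, w}"
        using that by blast
      then show ?thesis ..
    qed
    obtain a b c where abc: "e = {x, y, a}" "f = {x, z, b}" "g = {y, z, c}"
      using third e f g ne by metis
    \<comment> \<open>Each edge adds at most one vertex to \<open>x\<close>, \<open>y\<close>,
      \<open>z\<close>, so two of the edges coincide and that edge contains all three
      points.\<close>
    have "card (e \<union> f \<union> g) \<le> card (set [x, y, z, a, b, c])"
      by (rule card_mono) (auto simp: abc)
    also have "\<dots> \<le> 6"
      by (rule order_trans[OF card_length]) simp
    finally have "e = f \<or> f = g \<or> e = g"
      using three_edges_span[OF assms e(1) f(1) g(1)] by linarith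
    then obtain d where d: "d \<in> hyperedges H" "{x, y, z} \<subseteq> d"
      using e f g by auto
    then have "{x, y, z} = d"
      using ne card3[of d] by (intro card_subset_eq) auto
    then show ?thesis
      using d by simp
  qed
  have near_if: "near x y" if "D x y = 1 \<or> D x y = 2" "x \<noteq> y" for x y
    using that by (auto simp: D_def near_def far_def split: if_splits)
  have dist_values: "D x y = 1 \<or> D x y = 3 / 2 \<or> D x y = 2" if "x \<noteq> y" for x y
    using that by (simp add: D_def)
  have degenerate_edge: "degenerate (D x y) (D x z) (D y z)"
    if S: "{x, y, z} \<in> hyperedges H" and mid: "m {x, y, z} = y" and ne: "x \<noteq> y" "y \<noteq> z" "x \<noteq> z"
    for x y z
  proof -
    \<comment> \<open>Any edge through \<open>y\<close> and one of the ends shares two vertices with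
      the given edge, so its middle is \<open>y\<close> too and the short pairs are not far.\<close>
    have mid_eq: "m e = y" if "e \<in> hyperedges H" "y \<in> e" "x \<in> e \<or> z \<in> e" for e
      using two_common[OF S that(1), of x y] two_common[OF S that(1), of y z] that(2,3) mid ne
      by auto
    have "far x z"
      unfolding far_def by (rule bexI[OF _ S]) (use mid ne in simp)
    moreover have "near x y" "near y z"
      unfolding near_def by (rule bexI[OF _ S], simp)+
    moreover have "\<not> far x y" "\<not> far y z"
      unfolding far_def using mid_eq by blast+
    ultimately show ?thesis
      using ne by (simp add: D_def degenerate_def)
  qed
  show ?thesis
  proof (rule is_metricI[where D = D, OF unif])
    fix x y z
    show "D x z \<le> D x y + D y z"
      using dist_values[of x z] dist_values[of x y] dist_values[of y z]
      by (cases "x = y"; cases "y = z"; cases "x = z") (auto simp: D_def[of x x] D_def[of y y] D_def[of z z])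
    assume ne: "x \<noteq> y" "y \<noteq> z" "x \<noteq> z"
    show "degenerate (D x y) (D x z) (D y z) \<longleftrightarrow> {x, y, z} \<in> hyperedges H"
    proof
      assume "degenerate (D x y) (D x z) (D y z)"
      \<comment> \<open>Among sums of two of the values 1, 3/2, 2 only 1 + 1 is again such a value,
        so 3/2 cannot occur.\<close>
      then have "(D x y = 1 \<or> D x y = 2) \<and> (D x z = 1 \<or> D x z = 2) \<and> (D y z = 1 \<or> D y z = 2)"
        using dist_values[OF ne(1)] dist_values[OF ne(2)] dist_values[OF ne(3)] by (auto simp: degenerate_def)
      then show "{x, y, z} \<in> hyperedges H"
        using closed near_if ne by metis
    next
      assume S: "{x, y, z} \<in> hyperedges H"
      then consider "m {x, y, z} = x" | "m {x, y, z} = y" | "m {x, y, z} = z"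
        using m_in by blast
      then show "degenerate (D x y) (D x z) (D y z)"
      proof cases
        case 1
        then show ?thesis
          using degenerate_edge[of y x z] S ne
          by (auto simp: insert_commute degenerate_def sym[of y x])
      next
        case 2
        then show ?thesis
          using degenerate_edge S ne by blast
      next
        case 3
        then show ?thesis
          using degenerate_edge[of x z y] S ne
          by (auto simp: insert_commute degenerate_def sym[of z y])
      qed
    qed
  qed (auto simp: D_def near_def far_def)
qed

theorem theorem1:
  fixes H :: "'a hypergraph"
  assumes "finite (verts H)"
    and "uniform3 H"
    and "sparse 6 2 H"
  shows "is_metric H"
proof (cases "card (verts H) \<le> 5")
  case True
  then show ?thesis
    using is_metric_card_le_5 assms by blast
next
  case False
  then show ?thesis
    using is_metric_card_ge_6[OF assms(1) _ assms(2,3)] by simp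
qed

end
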